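(* Let $G=(V,E)$ be a connected graph with at least $3$ vertices. Then all vertices of $G$ except for exactly one have zero stress (that is, exactly one vertex of $G$ has nonzero stress) if and only if $G$ is a graph with a unique cut-vertex such that all its blocks are complete subgraphs of $G$.
   Context: Graphs are finite, undirected and simple. A geodesic is a shortest path between two vertices (a path and its reverse are the same geodesic); it passes through a vertex $v$ if $v$ is an internal vertex of it. The stress $\mathrm{str}(v)$ of a vertex $v$ is the number of geodesics in $G$ passing through $v$. A cut-vertex of $G$ is a vertex whose removal increases the number of components of $G$. A nonseparable graph is one that is connected, nontrivial (has at least two vertices) and has no cut-vertex. A block of $G$ is a maximal nonseparable subgraph of $G$. *)

theory Defs
  imports "Graph_Theory.Digraph_Component_Vwalk" "Graph_Theory.Kuratowski"
begin

text \<open>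
  A finite simple undirected graph is an instance of the locale \<^locale>\<open>graph\<close>: a finite loop-free
  digraph without parallel arcs whose arc relation is symmetric, so that an undirected edge is a
  pair of opposite arcs. Paths are given by their vertex sequences (\<^const>\<open>vpath\<close>), which determine
  them since there are no parallel arcs.
\<close>

definition geodesic :: "('a, 'b) pre_digraph \<Rightarrow> 'a list \<Rightarrow> bool" where
  "geodesic G p \<longleftrightarrow> vpath p G \<and>
     (\<forall>q. vpath q G \<and> hd q = hd p \<and> last q = last p \<longrightarrow> vwalk_length p \<le> vwalk_length q)"

definition passes_through :: "'a list \<Rightarrow> 'a \<Rightarrow> bool" where
  "passes_through p v \<longleftrightarrow> v \<in> set (butlast (tl p))"

text \<open>A vertex sequence and its reverse are the same geodesic, represented by the set
  \<open>{p, rev p}\<close>.\<close>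

definition stress :: "('a, 'b) pre_digraph \<Rightarrow> 'a \<Rightarrow> nat" where
  "stress G v = card {{p, rev p} | p. geodesic G p \<and> passes_through p v}"

text \<open>For symmetric digraphs, the members of \<^const>\<open>pre_digraph.sccs\<close> are the connected
  components.\<close>

definition cut_vertex :: "('a, 'b) pre_digraph \<Rightarrow> 'a \<Rightarrow> bool" where
  "cut_vertex G v \<longleftrightarrow> v \<in> verts G \<and>
     card (pre_digraph.sccs (pre_digraph.del_vert G v)) > card (pre_digraph.sccs G)"

text \<open>The conjunct \<^term>\<open>graph H\<close> restricts the subgraphs considered for blocks to undirected ones;
  \<^const>\<open>subgraph\<close> by itself also admits sub-digraphs containing only one of two opposite
  arcs.\<close>

definition nonseparable :: "('a, 'b) pre_digraph \<Rightarrow> bool" where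
  "nonseparable H \<longleftrightarrow> graph H \<and> connected H \<and> card (verts H) \<ge> 2 \<and> \<not> (\<exists>v. cut_vertex H v)"

definition block :: "('a, 'b) pre_digraph \<Rightarrow> ('a, 'b) pre_digraph \<Rightarrow> bool" where
  "block G B \<longleftrightarrow> pre_digraph.max_subgraph G nonseparable B"

definition complete_graph :: "('a, 'b) pre_digraph \<Rightarrow> bool" where
  "complete_graph H \<longleftrightarrow> complete_digraph (card (verts H)) H"

end

theory Submission
  imports Defs
begin

text \<open>
  Nonzero stress is a local condition. The two neighbours of \<open>v\<close> on a geodesic through \<open>v\<close> are not
  adjacent, since an edge between them would shorten the geodesic; conversely, if \<open>u\<close> and \<open>w\<close> are
  distinct non-adjacent neighbours of \<open>v\<close>, then \<open>u, v, w\<close> is a geodesic. So \<open>v\<close> has zero stress iff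
  its neighbours are pairwise adjacent (\<open>stress_nonzero_iff\<close>), and the theorem becomes a statement
  about adjacency. In a connected graph every cut-vertex \<open>v\<close> has nonzero stress, because each
  component left by its removal contains a neighbour of \<open>v\<close> (\<open>cut_vertex_imp_stress\<close>).

  Let \<open>c\<close> be the only vertex with nonzero stress. Along a walk that avoids \<open>c\<close>, adjacency is
  transitive, so every connected subgraph that avoids \<open>c\<close> has pairwise adjacent vertices
  (\<open>adjacent_if_reachable_avoiding\<close>). Two non-adjacent neighbours of \<open>c\<close> are therefore separated by
  the removal of \<open>c\<close>, which makes \<open>c\<close> a cut-vertex. A block \<open>B\<close> stays connected without \<open>c\<close>, so
  the vertices of \<open>B\<close> other than \<open>c\<close> are pairwise adjacent; if \<open>c\<close> lies in \<open>B\<close>, it has a neighbour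
  \<open>y\<close> there, and as \<open>y\<close> has zero stress, \<open>c\<close> is adjacent to all other vertices of \<open>B\<close>. A complete
  graph is nonseparable, so by maximality \<open>B\<close> contains all edges of \<open>G\<close> between its vertices
  (\<open>block_complete_if_stress_zero\<close>).

  Conversely, let all blocks be complete, and suppose that \<open>v\<close> is not a cut-vertex but has distinct
  non-adjacent neighbours \<open>u\<close> and \<open>w\<close>. A path from \<open>w\<close> to \<open>u\<close> that avoids \<open>v\<close> closes up to a cycle
  through \<open>v\<close>. The subgraph induced by the vertices of a cycle is nonseparable
  (\<open>cycle_nonseparable\<close>) and so lies in a block (\<open>ex_block_containing\<close>), which is complete; hence
  \<open>u\<close> and \<open>w\<close> are adjacent, a contradiction. So the vertices with nonzero stress are exactly the
  cut-vertices (\<open>cut_vertex_if_stress\<close>), and uniqueness carries over.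
\<close>

section \<open>Stress and non-adjacent neighbours\<close>

text \<open>
  \<^const>\<open>successively\<close> splits at \<^term>\<open>(@)\<close> by a rewrite rule, which makes it easy to cut walks and
  to leave vertices out of them.
\<close>

lemma vwalk_conv_successively:
  "vwalk p G \<longleftrightarrow> p \<noteq> [] \<and> set p \<subseteq> verts G \<and> successively (\<lambda>x y. x \<rightarrow>\<^bsub>G\<^esub> y) p"
proof -
  have "set (vwalk_arcs p) \<subseteq> arcs_ends G \<longleftrightarrow> successively (\<lambda>x y. x \<rightarrow>\<^bsub>G\<^esub> y) p"
    by (induction p rule: vwalk_arcs.induct) auto
  then show ?thesis
    by (auto simp: vwalk_def)
qed

lemma passes_through_split:
  assumes "passes_through p v"
  obtains xs a b ys where "p = xs @ [a, v, b] @ ys"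
proof -
  from assms have "v \<in> set (butlast (tl p))"
    by (simp add: passes_through_def)
  then obtain x q y where p: "p = x # q @ [y]" and "v \<in> set q"
    by (cases p; cases "tl p" rule: rev_cases) auto
  then obtain ps qs where q: "q = ps @ v # qs"
    by (meson split_list)
  obtain xs a where "x # ps = xs @ [a]"
    by (cases "x # ps" rule: rev_cases) auto
  moreover obtain b ys where "qs @ [y] = b # ys"
    by (cases "qs @ [y]") auto
  ultimately have "p = xs @ [a, v, b] @ ys"
    using p q by (metis append.assoc append_Cons append_Nil)
  then show ?thesis ..
qed

context graph
begin

lemma geodesic_two_steps:
  assumes "u \<rightarrow>\<^bsub>G\<^esub> v" "v \<rightarrow>\<^bsub>G\<^esub> w" "u \<noteq> w" "\<not> u \<rightarrow>\<^bsub>G\<^esub> w"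
  shows "geodesic G [u, v, w]"
  unfolding geodesic_def
proof (intro conjI allI impI)
  show "vpath [u, v, w] G"
    using assms adj_not_same adj_in_verts[OF assms(1)] adj_in_verts[OF assms(2)]
    by (auto simp: vpath_def vwalk_conv_successively)
next
  fix q assume q: "vpath q G \<and> hd q = hd [u, v, w] \<and> last q = last [u, v, w]"
  consider "q = []" | x where "q = [x]" | x y where "q = [x, y]"
    | x y z zs where "q = x # y # z # zs"
    by (metis list.exhaust)
  then show "vwalk_length [u, v, w] \<le> vwalk_length q"
    using q assms by cases (auto simp: vpath_def vwalk_conv_successively)
qed

lemma geodesic_consecutive_not_adjacent:
  assumes "geodesic G (xs @ [a, v, b] @ ys)"
  shows "a \<rightarrow>\<^bsub>G\<^esub> v" "v \<rightarrow>\<^bsub>G\<^esub> b" "a \<noteq> b" "\<not> a \<rightarrow>\<^bsub>G\<^esub> b"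
proof -
  let ?p = "xs @ [a, v, b] @ ys" and ?q = "xs @ [a, b] @ ys"
  have p: "vpath ?p G"
    using assms by (simp add: geodesic_def)
  then show "a \<rightarrow>\<^bsub>G\<^esub> v" "v \<rightarrow>\<^bsub>G\<^esub> b" "a \<noteq> b"
    by (auto simp: vpath_def vwalk_conv_successively successively_append_iff)
  show "\<not> a \<rightarrow>\<^bsub>G\<^esub> b"
  proof
    assume "a \<rightarrow>\<^bsub>G\<^esub> b"
    then have "vpath ?q G"
      using p by (auto simp: vpath_def vwalk_conv_successively successively_append_iff
          successively_Cons)
    moreover have "hd ?q = hd ?p" "last ?q = last ?p"
      by (auto simp: hd_append)
    ultimately have "vwalk_length ?p \<le> vwalk_length ?q"
      using assms unfolding geodesic_def by blast
    then show False
      by simp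
  qed
qed

text \<open>
  In a finite graph there are only finitely many paths, so the cardinality in the definition of
  \<^const>\<open>stress\<close> vanishes only if no geodesic passes through \<open>v\<close>. Geodesics through \<open>v\<close> can be
  replaced by their segments of length two around \<open>v\<close>.
\<close>

lemma stress_nonzero_iff:
  "stress G v \<noteq> 0 \<longleftrightarrow> (\<exists>u w. u \<rightarrow>\<^bsub>G\<^esub> v \<and> v \<rightarrow>\<^bsub>G\<^esub> w \<and> u \<noteq> w \<and> \<not> u \<rightarrow>\<^bsub>G\<^esub> w)"
proof -
  let ?P = "{p. geodesic G p \<and> passes_through p v}"
  have "finite ?P"
    by (rule finite_subset[OF _ vpaths_finite]) (auto simp: geodesic_def)
  moreover have "{{p, rev p} | p. geodesic G p \<and> passes_through p v} = (\<lambda>p. {p, rev p}) ` ?P"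
    by auto
  ultimately have "stress G v \<noteq> 0 \<longleftrightarrow> ?P \<noteq> {}"
    by (simp add: stress_def)
  also have "\<dots> \<longleftrightarrow> (\<exists>u w. u \<rightarrow>\<^bsub>G\<^esub> v \<and> v \<rightarrow>\<^bsub>G\<^esub> w \<and> u \<noteq> w \<and> \<not> u \<rightarrow>\<^bsub>G\<^esub> w)"
  proof
    assume "?P \<noteq> {}"
    then obtain p where "geodesic G p" "passes_through p v"
      by auto
    then show "\<exists>u w. u \<rightarrow>\<^bsub>G\<^esub> v \<and> v \<rightarrow>\<^bsub>G\<^esub> w \<and> u \<noteq> w \<and> \<not> u \<rightarrow>\<^bsub>G\<^esub> w"
      by (metis passes_through_split geodesic_consecutive_not_adjacent)
  next
    assume "\<exists>u w. u \<rightarrow>\<^bsub>G\<^esub> v \<and> v \<rightarrow>\<^bsub>G\<^esub> w \<and> u \<noteq> w \<and> \<not> u \<rightarrow>\<^bsub>G\<^esub> w"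
    then obtain u w where "geodesic G [u, v, w]"
      using geodesic_two_steps by blast
    then show "?P \<noteq> {}"
      by (auto simp: passes_through_def)
  qed
  finally show ?thesis .
qed

end

section \<open>Connectedness and cut-vertices\<close>

lemma adj_induce_subgraph_iff:
  "u \<rightarrow>\<^bsub>G \<restriction> S\<^esub> v \<longleftrightarrow> u \<rightarrow>\<^bsub>G\<^esub> v \<and> u \<in> S \<and> v \<in> S"
  by (auto simp: arcs_ends_conv)

lemma induce_induce_subgraph:
  assumes "T \<subseteq> S"
  shows "(G \<restriction> S) \<restriction> T = G \<restriction> T"
  using assms by (auto simp: induce_subgraph_def)

lemma vwalk_induce_subgraph:
  assumes "vwalk p G" "set p \<subseteq> S"
  shows "vwalk p (G \<restriction> S)"
proof -
  have "successively (\<lambda>x y. x \<rightarrow>\<^bsub>G \<restriction> S\<^esub> y) p"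
    by (rule successively_mono[of "\<lambda>x y. x \<rightarrow>\<^bsub>G\<^esub> y"])
      (use assms in \<open>auto simp: vwalk_conv_successively adj_induce_subgraph_iff\<close>)
  then show ?thesis
    using assms by (auto simp: vwalk_conv_successively)
qed

lemma (in wf_digraph) vwalk_hd_reachable:
  assumes "vwalk p G" "x \<in> set p"
  shows "hd p \<rightarrow>\<^sup>* x"
proof -
  obtain ys zs where p: "p = ys @ x # zs"
    using assms(2) by (meson split_list)
  then have "vwalk (ys @ [x]) G" "hd (ys @ [x]) = hd p"
    using assms(1) by (auto simp: vwalk_conv_successively successively_append_iff hd_append)
  then show ?thesis
    unfolding reachable_vwalk_conv by (metis last_snoc)
qed

context graph
begin

lemma graph_subgraphI:
  assumes "subgraph H G" "symmetric H"
  shows "graph H"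
  using digraph_subgraph[OF assms(1)] assms(2) by (rule digraph.graphI)

lemma graph_induce_subgraph:
  assumes "S \<subseteq> verts G"
  shows "graph (G \<restriction> S)"
  using assms
  by (intro graph_subgraphI induced_graph_imp_symmetric[OF sym_arcs] subgraph_induce_subgraphI
      induced_induce)

lemma connected_iff_strongly_connected: "connected G \<longleftrightarrow> strongly_connected G"
  by (simp add: connected_def strongly_connected_def reachable_mk_symmetric_eq[OF sym_arcs])

lemma strongly_connected_from_root:
  assumes "r \<in> verts G" "\<And>x. x \<in> verts G \<Longrightarrow> r \<rightarrow>\<^sup>* x"
  shows "strongly_connected G"
  using assms by (blast intro: reachable_trans symmetric_reachable')

lemma card_sccs_connected:
  assumes "strongly_connected G"
  shows "card sccs = 1"
  using assms by (simp add: strongly_connected_eq_iff)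

text \<open>
  By symmetry, two vertices lie in the same component as soon as one reaches the other.
\<close>

lemma card_sccs_greater_1_iff:
  "card sccs > 1 \<longleftrightarrow> (\<exists>a\<in>verts G. \<exists>b\<in>verts G. \<not> a \<rightarrow>\<^sup>* b)"
proof -
  have "card sccs > 1 \<longleftrightarrow> (\<exists>A\<in>sccs_verts. \<exists>B\<in>sccs_verts. A \<noteq> B)"
    unfolding card_sccs_verts[symmetric]
    using card_le_Suc0_iff_eq[OF finite_sccs_verts] by (auto simp: not_le[symmetric])
  also have "\<dots> \<longleftrightarrow> (\<exists>a\<in>verts G. \<exists>b\<in>verts G. scc_of a \<noteq> scc_of b)"
    by (simp add: sccs_verts_conv_scc_of)
  also have "\<dots> \<longleftrightarrow> (\<exists>a\<in>verts G. \<exists>b\<in>verts G. \<not> a \<rightarrow>\<^sup>* b)"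
  proof -
    have "scc_of a = scc_of b \<longleftrightarrow> a \<rightarrow>\<^sup>* b" if "a \<in> verts G" for a b
    proof
      assume "scc_of a = scc_of b"
      then have "a \<in> scc_of b"
        using that in_scc_of_self by blast
      then show "a \<rightarrow>\<^sup>* b"
        by (simp add: scc_of_def)
    qed (simp add: scc_ofI_reachable scc_of_eq)
    then show ?thesis by blast
  qed
  finally show ?thesis .
qed

lemma del_vert_eq_induce: "del_vert v = G \<restriction> (verts G - {v})"
  by (auto simp: del_vert_def induce_subgraph_def)

text \<open>
  A connected graph has exactly one component, so a vertex is a cut-vertex as soon as its removal
  leaves two components.
\<close>

lemma cut_vertex_iff:
  assumes "connected G"
  shows "cut_vertex G v \<longleftrightarrow> v \<in> verts G \<and>
    (\<exists>a\<in>verts G - {v}. \<exists>b\<in>verts G - {v}. \<not> a \<rightarrow>\<^sup>*\<^bsub>G \<restriction> (verts G - {v})\<^esub> b)"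
proof -
  interpret D: graph "G \<restriction> (verts G - {v})"
    by (rule graph_induce_subgraph) auto
  show ?thesis
    using assms card_sccs_connected D.card_sccs_greater_1_iff
    by (simp add: cut_vertex_def del_vert_eq_induce connected_iff_strongly_connected)
qed

text \<open>
  Each of two vertices separated by the removal of \<open>v\<close> is still joined to a neighbour of \<open>v\<close>: walk
  from it towards \<open>v\<close> and stop just before \<open>v\<close> is reached for the first time. The two neighbours
  found in this way lie in different components, so they are distinct and not adjacent.
\<close>

lemma cut_vertex_imp_stress:
  assumes "connected G" "cut_vertex G v"
  shows "stress G v \<noteq> 0"
proof -
  let ?D = "G \<restriction> (verts G - {v})"
  interpret D: graph ?D
    by (rule graph_induce_subgraph) auto
  obtain a b where ab: "v \<in> verts G" "a \<in> verts G - {v}" "b \<in> verts G - {v}" "\<not> a \<rightarrow>\<^sup>*\<^bsub>?D\<^esub> b"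
    using assms by (auto simp: cut_vertex_iff)
  have attach: "\<exists>y. y \<rightarrow>\<^bsub>G\<^esub> v \<and> x \<rightarrow>\<^sup>*\<^bsub>?D\<^esub> y" if "x \<in> verts G - {v}" for x
  proof -
    have "x \<rightarrow>\<^sup>* v"
      using assms(1) that ab(1) by (auto simp: connected_iff_strongly_connected)
    then have "x = v \<or> (\<exists>y. y \<rightarrow>\<^bsub>G\<^esub> v \<and> x \<rightarrow>\<^sup>*\<^bsub>?D\<^esub> y)"
    proof induction
      case (step x z)
      show ?case
      proof (cases "x = v \<or> z = v")
        case True
        then show ?thesis
          using step.hyps(1) adj_in_verts by auto
      next
        case False
        then have "x \<rightarrow>\<^bsub>?D\<^esub> z"
          using step.hyps(1) adj_in_verts by (auto simp: adj_induce_subgraph_iff)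
        then show ?thesis
          using step.IH False D.adj_reachable_trans by blast
      qed
    qed auto
    then show ?thesis
      using that by auto
  qed
  obtain y z where y: "y \<rightarrow>\<^bsub>G\<^esub> v" "a \<rightarrow>\<^sup>*\<^bsub>?D\<^esub> y" and z: "z \<rightarrow>\<^bsub>G\<^esub> v" "b \<rightarrow>\<^sup>*\<^bsub>?D\<^esub> z"
    using attach ab by meson
  have not_reach: "\<not> y \<rightarrow>\<^sup>*\<^bsub>?D\<^esub> z"
    using ab(4) y(2) z(2) D.reachable_trans D.symmetric_reachable' by blast
  moreover have "y \<in> verts ?D" "z \<in> verts ?D"
    using y(2) z(2) D.reachable_in_verts by blast+
  ultimately have "y \<noteq> z" "\<not> y \<rightarrow>\<^bsub>G\<^esub> z"
    by (auto simp: adj_induce_subgraph_iff)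
  then show ?thesis
    unfolding stress_nonzero_iff using y(1) z(1) graph_symmetric by blast
qed

section \<open>Blocks\<close>

text \<open>
  The walk from \<open>a\<close> to \<open>b\<close> is contracted to one edge step by step: each inner vertex of it differs
  from \<open>c\<close> and has zero stress, so its predecessor and successor are equal or adjacent.
\<close>

lemma adjacent_if_reachable_avoiding:
  assumes "subgraph H G" "c \<notin> verts H"
    and stress: "\<And>v. v \<in> verts G \<Longrightarrow> v \<noteq> c \<Longrightarrow> stress G v = 0"
    and "a \<rightarrow>\<^sup>*\<^bsub>H\<^esub> b"
  shows "a = b \<or> a \<rightarrow>\<^bsub>G\<^esub> b"
proof -
  interpret H: wf_digraph H
    using assms(1) by auto
  show ?thesis
    using \<open>a \<rightarrow>\<^sup>*\<^bsub>H\<^esub> b\<close>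
  proof (induction rule: H.reachable_induct)
    case (step x y)
    have "x \<in> verts G" "x \<noteq> c"
      using H.adj_in_verts[OF step.hyps(2)] assms(1,2) by auto
    moreover have "x \<rightarrow>\<^bsub>G\<^esub> y"
      using step.hyps(2) assms(1) by (rule adj_mono)
    ultimately show ?case
      using step.IH stress[of x] stress_nonzero_iff[of x] by blast
  qed auto
qed

lemma complete_induce_subgraph_nonseparable:
  assumes "S \<subseteq> verts G" "card S \<ge> 2"
    and complete: "\<And>a b. a \<in> S \<Longrightarrow> b \<in> S \<Longrightarrow> a \<noteq> b \<Longrightarrow> a \<rightarrow>\<^bsub>G\<^esub> b"
  shows "nonseparable (G \<restriction> S)"
proof -
  interpret H: graph "G \<restriction> S"
    using assms(1) by (rule graph_induce_subgraph)
  have "S \<noteq> {}"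
    using assms(2) by auto
  have reach: "a \<rightarrow>\<^sup>*\<^bsub>G \<restriction> T\<^esub> b" if "a \<in> T" "b \<in> T" "T \<subseteq> S" for T a b
  proof -
    interpret T: graph "G \<restriction> T"
      using that(3) assms(1) by (intro graph_induce_subgraph) auto
    show ?thesis
    proof (cases "a = b")
      case False
      then show ?thesis
        using that complete by (intro T.reachable_adjI) (auto simp: adj_induce_subgraph_iff)
    qed (use that in auto)
  qed
  have con: "connected (G \<restriction> S)"
    unfolding H.connected_iff_strongly_connected using reach \<open>S \<noteq> {}\<close>
    by (intro strongly_connectedI) auto
  moreover have "\<not> cut_vertex (G \<restriction> S) v" for v
    using reach by (auto simp: H.cut_vertex_iff[OF con] induce_induce_subgraph)
  ultimately show ?thesis
    using assms(2) H.graph_axioms by (simp add: nonseparable_def)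
qed

text \<open>
  Adjacency in \<open>G\<close> carries over to \<open>B\<close> by maximality: the subgraph of \<open>G\<close> induced by the vertices
  of \<open>B\<close> is complete, hence nonseparable, and so equals \<open>B\<close>.
\<close>

lemma block_complete_if_pairwise_adjacent:
  assumes "block G B"
    and complete: "\<And>a b. a \<in> verts B \<Longrightarrow> b \<in> verts B \<Longrightarrow> a \<noteq> b \<Longrightarrow> a \<rightarrow>\<^bsub>G\<^esub> b"
  shows "complete_graph B"
proof -
  let ?K = "G \<restriction> verts B"
  have B: "subgraph B G" "nonseparable B"
    using assms(1) by (auto simp: block_def max_subgraph_def)
  then have sub: "verts B \<subseteq> verts G"
    by auto
  have "nonseparable ?K"
    using sub B(2) complete
    by (intro complete_induce_subgraph_nonseparable) (auto simp: nonseparable_def)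
  moreover have "subgraph B ?K" "subgraph ?K G"
    using B(1) sub by (auto intro: subgraph_induce_subgraphI2 subgraph_induce_subgraphI)
  ultimately have "B = ?K"
    using assms(1) unfolding block_def max_subgraph_def by metis
  moreover interpret H: graph B
    using B(2) by (simp add: nonseparable_def)
  have "arcs_ends ?K = {(u, v). (u, v) \<in> verts B \<times> verts B \<and> u \<noteq> v}"
    using complete adj_not_same by (auto simp: adj_induce_subgraph_iff)
  ultimately show ?thesis
    using H.graph_axioms by (simp add: complete_graph_def complete_digraph_def)
qed

text \<open>
  The vertex \<open>c\<close> is not a cut-vertex of the block, so the block without \<open>c\<close> is connected and any two
  of its vertices are adjacent in \<open>G\<close>. If \<open>c\<close> is in the block, it has a neighbour \<open>y\<close> there; all
  other vertices of the block are neighbours of \<open>y\<close> and, as \<open>y\<close> has zero stress, also of \<open>c\<close>.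
\<close>

lemma block_complete_if_stress_zero:
  assumes stress: "\<And>v. v \<in> verts G \<Longrightarrow> v \<noteq> c \<Longrightarrow> stress G v = 0"
    and "block G B"
  shows "complete_graph B"
proof (rule block_complete_if_pairwise_adjacent[OF assms(2)])
  have sub: "subgraph B G" and "nonseparable B"
    using assms(2) by (auto simp: block_def max_subgraph_def)
  interpret B: graph B
    using \<open>nonseparable B\<close> by (simp add: nonseparable_def)
  let ?D = "B \<restriction> (verts B - {c})"
  interpret D: graph ?D
    by (rule B.graph_induce_subgraph) auto
  have B: "connected B" "\<not> cut_vertex B c"
    using \<open>nonseparable B\<close> by (auto simp: nonseparable_def)
  have "subgraph ?D B"
    by (rule B.subgraph_induce_subgraphI) auto
  with sub have sub_D: "subgraph ?D G"
    using subgraph_trans by blast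
  have reach_D: "a \<rightarrow>\<^sup>*\<^bsub>?D\<^esub> b" if "a \<in> verts B" "b \<in> verts B" "a \<noteq> c" "b \<noteq> c" for a b
  proof (cases "c \<in> verts B")
    case True
    then show ?thesis
      using B that by (auto simp: B.cut_vertex_iff)
  next
    case False
    then have "?D = B"
      using B.induce_eq_iff_induced[OF B.induced_subgraph_refl] by simp
    then show ?thesis
      using B(1) that by (auto simp: B.connected_iff_strongly_connected)
  qed
  have off_c: "a \<rightarrow>\<^bsub>G\<^esub> b" if "a \<in> verts B" "b \<in> verts B" "a \<noteq> c" "b \<noteq> c" "a \<noteq> b" for a b
    using adjacent_if_reachable_avoiding[OF sub_D _ stress reach_D] that by auto
  have at_c: "c \<rightarrow>\<^bsub>G\<^esub> b" if "c \<in> verts B" "b \<in> verts B" "b \<noteq> c" for b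
  proof -
    have "c \<rightarrow>\<^sup>*\<^bsub>B\<^esub> b"
      using B(1) that by (auto simp: B.connected_iff_strongly_connected)
    then obtain y where "c \<rightarrow>\<^bsub>B\<^esub> y"
      using \<open>b \<noteq> c\<close> by (cases rule: B.converse_reachable_cases) auto
    then have y: "c \<rightarrow>\<^bsub>G\<^esub> y" "y \<in> verts B" "y \<noteq> c"
      using sub adj_mono B.adj_in_verts B.adj_not_same by blast+
    show ?thesis
    proof (cases "y = b")
      case False
      then have "y \<rightarrow>\<^bsub>G\<^esub> b"
        using off_c y that by blast
      moreover have "stress G y = 0"
        using stress y sub by auto
      ultimately show ?thesis
        using y(1) \<open>b \<noteq> c\<close> stress_nonzero_iff[of y] by blast
    qed (use y in simp)
  qed
  show "a \<rightarrow>\<^bsub>G\<^esub> b" if "a \<in> verts B" "b \<in> verts B" "a \<noteq> b" for a b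
    using that off_c at_c graph_symmetric by metis
qed

text \<open>
  Among the nonseparable subgraphs of \<open>G\<close> that contain \<open>H\<close>, one with the largest total number of
  vertices and arcs is maximal, because a proper subgraph lacks a vertex or an arc.
\<close>

lemma ex_block_containing:
  assumes "subgraph H G" "nonseparable H"
  obtains B where "block G B" "subgraph H B"
proof -
  let ?P = "\<lambda>K. subgraph H K \<and> subgraph K G \<and> nonseparable K"
  let ?size = "\<lambda>K. card (verts K) + card (arcs K)"
  have "?P H"
    using assms wf_digraph.subgraph_refl by (auto simp: subgraph_def)
  moreover have "\<forall>K. ?P K \<longrightarrow> ?size K < Suc (card (verts G) + card (arcs G))"
    by (auto simp: less_Suc_eq_le intro!: add_mono card_mono)
  ultimately have "\<exists>B. ?P B \<and> (\<forall>K. ?P K \<longrightarrow> ?size K \<le> ?size B)"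
    by (rule ex_has_greatest_nat)
  then obtain B where B: "?P B" and max: "\<And>K. ?P K \<Longrightarrow> ?size K \<le> ?size B"
    by blast
  have "K = B" if "subgraph B K" "subgraph K G" "nonseparable K" for K
  proof -
    have "?size K \<le> ?size B"
      using that B subgraph_trans max by blast
    moreover have fin: "finite (verts K)" "finite (arcs K)"
      using that(2) fin_digraph_subgraph fin_digraph.finite_verts fin_digraph.finite_arcs by blast+
    have sub: "verts B \<subseteq> verts K" "arcs B \<subseteq> arcs K"
      using that(1) by auto
    ultimately have "verts B = verts K" "arcs B = arcs K"
      using card_seteq[OF fin(1) sub(1)] card_seteq[OF fin(2) sub(2)]
        card_mono[OF fin(1) sub(1)] card_mono[OF fin(2) sub(2)]
      by linarith+
    moreover have "tail B = tail K" "head B = head K"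
      using that(1) by (auto simp: subgraph_def compatible_def)
    ultimately show ?thesis
      by simp
  qed
  then have "block G B"
    using B by (auto simp: block_def max_subgraph_def)
  then show ?thesis
    using B that by blast
qed

text \<open>
  Here \<open>v\<close> followed by \<open>p\<close> is a cycle, or a single edge if \<open>p\<close> has only one vertex. Removing \<open>v\<close>
  leaves the path \<open>p\<close>. Removing a vertex of \<open>p\<close> leaves two possibly empty pieces of \<open>p\<close>, and
  each nonempty one is still attached to \<open>v\<close> at its outer end.
\<close>

lemma cycle_nonseparable:
  assumes "vpath p G" "v \<notin> set p" "v \<rightarrow>\<^bsub>G\<^esub> hd p" "last p \<rightarrow>\<^bsub>G\<^esub> v"
  shows "nonseparable (G \<restriction> insert v (set p))"
proof -
  let ?S = "insert v (set p)"
  have p: "vwalk p G" "distinct p" "p \<noteq> []"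
    using assms(1) by (auto simp: vpath_def)
  have "v \<in> verts G"
    using assms(3) adj_in_verts by blast
  then have S: "?S \<subseteq> verts G"
    using p(1) by auto
  have reach_p: "hd q \<rightarrow>\<^sup>*\<^bsub>G \<restriction> T\<^esub> y"
    if "vwalk q G" "set q \<subseteq> T" "y \<in> set q" "T \<subseteq> verts G" for q T y
  proof -
    interpret T: graph "G \<restriction> T"
      using that(4) by (rule graph_induce_subgraph)
    show ?thesis
      using T.vwalk_hd_reachable vwalk_induce_subgraph that by blast
  qed
  interpret H: graph "G \<restriction> ?S"
    using S by (rule graph_induce_subgraph)
  have "strongly_connected (G \<restriction> ?S)"
  proof (rule H.strongly_connected_from_root)
    fix x assume x: "x \<in> verts (G \<restriction> ?S)"
    have "v \<rightarrow>\<^bsub>G \<restriction> ?S\<^esub> hd p"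
      using assms(3) p(3) by (simp add: adj_induce_subgraph_iff)
    moreover have "x = v \<or> hd p \<rightarrow>\<^sup>*\<^bsub>G \<restriction> ?S\<^esub> x"
      using x reach_p[OF p(1) _ _ S] by auto
    ultimately show "v \<rightarrow>\<^sup>*\<^bsub>G \<restriction> ?S\<^esub> x"
      using x H.adj_reachable_trans by blast
  qed simp
  then have con: "connected (G \<restriction> ?S)"
    by (simp add: H.connected_iff_strongly_connected)
  have "\<not> cut_vertex (G \<restriction> ?S) x" for x
  proof
    assume cut: "cut_vertex (G \<restriction> ?S) x"
    let ?D = "G \<restriction> (?S - {x})"
    have D: "(G \<restriction> ?S) \<restriction> (verts (G \<restriction> ?S) - {x}) = ?D"
      by (simp add: induce_induce_subgraph)
    have sub: "?S - {x} \<subseteq> verts G"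
      using S by auto
    interpret D: graph ?D
      using sub by (rule graph_induce_subgraph)
    have "x \<in> ?S" and not_con: "\<not> strongly_connected ?D"
      using cut unfolding H.cut_vertex_iff[OF con] D by auto
    consider "x = v" | p1 p2 where "p = p1 @ x # p2"
      using \<open>x \<in> ?S\<close> by (auto dest: split_list)
    then have "strongly_connected ?D"
    proof cases
      case 1
      show ?thesis
        by (rule D.strongly_connected_from_root[of "hd p"])
          (use 1 p assms(2) reach_p[OF p(1) _ _ sub] in auto)
    next
      case 2
      have x: "x \<notin> set p1" "x \<notin> set p2" "x \<noteq> v"
        using p(2) 2 assms(2) by auto
      show ?thesis
      proof (rule D.strongly_connected_from_root)
        fix y assume "y \<in> verts ?D"
        then consider "y = v" | "y \<in> set p1" | "y \<in> set p2"
          using 2 by auto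
        then show "v \<rightarrow>\<^sup>*\<^bsub>?D\<^esub> y"
        proof cases
          case 2
          then have "v \<rightarrow>\<^bsub>?D\<^esub> hd p1"
            using assms(3) \<open>p = _\<close> x by (cases p1) (auto simp: adj_induce_subgraph_iff)
          moreover have "vwalk p1 G"
            using p(1) \<open>p = _\<close> 2 by (auto simp: vwalk_conv_successively successively_append_iff)
          then have "hd p1 \<rightarrow>\<^sup>*\<^bsub>?D\<^esub> y"
            using 2 x \<open>p = _\<close> sub by (intro reach_p) auto
          ultimately show ?thesis
            by (rule D.adj_reachable_trans)
        next
          case 3
          then have "p2 \<noteq> []"
            by auto
          then have "last p2 \<rightarrow>\<^bsub>?D\<^esub> v"
            using assms(4) \<open>p = _\<close> x by (auto simp: adj_induce_subgraph_iff)
          moreover have "vwalk p2 G"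
            using p(1) \<open>p = _\<close> \<open>p2 \<noteq> []\<close>
            by (auto simp: vwalk_conv_successively successively_append_iff successively_Cons)
          then have "hd p2 \<rightarrow>\<^sup>*\<^bsub>?D\<^esub> z" if "z \<in> set p2" for z
            using that x \<open>p = _\<close> sub by (intro reach_p) auto
          then have "hd p2 \<rightarrow>\<^sup>*\<^bsub>?D\<^esub> y" "hd p2 \<rightarrow>\<^sup>*\<^bsub>?D\<^esub> last p2"
            using 3 \<open>p2 \<noteq> []\<close> by auto
          ultimately show ?thesis
            by (meson D.reachable_trans D.reachable_adjI D.symmetric_reachable')
        qed (use x in auto)
      qed (use x in auto)
    qed
    then show False
      using not_con by simp
  qed
  moreover have "card ?S \<ge> 2"
    using assms(2) p(2,3) by (cases p) (auto simp: distinct_card)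
  ultimately show ?thesis
    using con H.graph_axioms by (simp add: nonseparable_def)
qed

section \<open>Vertices of nonzero stress as cut-vertices\<close>

text \<open>
  If \<open>v\<close> were not a cut-vertex, two non-adjacent neighbours of \<open>v\<close> would lie on a common cycle,
  hence in a common block, which is complete.
\<close>

lemma cut_vertex_if_stress:
  assumes "connected G" and blocks: "\<And>B. block G B \<Longrightarrow> complete_graph B"
    and "stress G v \<noteq> 0"
  shows "cut_vertex G v"
proof (rule ccontr)
  assume not_cut: "\<not> cut_vertex G v"
  obtain u w where uw: "u \<rightarrow>\<^bsub>G\<^esub> v" "v \<rightarrow>\<^bsub>G\<^esub> w" "u \<noteq> w" "\<not> u \<rightarrow>\<^bsub>G\<^esub> w"
    using assms(3) stress_nonzero_iff by auto
  then have verts: "u \<in> verts G - {v}" "w \<in> verts G - {v}" "v \<in> verts G"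
    using adj_in_verts adj_not_same by blast+
  let ?D = "G \<restriction> (verts G - {v})"
  interpret D: graph ?D
    by (rule graph_induce_subgraph) auto
  have "w \<rightarrow>\<^sup>*\<^bsub>?D\<^esub> u"
    using not_cut verts by (auto simp: cut_vertex_iff[OF assms(1)])
  then obtain p where p: "vpath p ?D" "hd p = w" "last p = u"
    by (auto simp: D.reachable_vpath_conv)
  then have "v \<notin> set p" "p \<noteq> []"
    by (auto simp: vpath_def vwalk_conv_successively)
  have "subgraph ?D G"
    by (rule subgraph_induce_subgraphI) auto
  let ?C = "G \<restriction> insert v (set p)"
  have pG: "vpath p G"
    using p(1) \<open>subgraph ?D G\<close> by (rule vpathI_subgraph)
  then have "nonseparable ?C"
    using \<open>v \<notin> set p\<close> uw p by (intro cycle_nonseparable) auto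
  moreover have "subgraph ?C G"
    using pG verts(3) by (intro subgraph_induce_subgraphI) auto
  ultimately obtain B where B: "block G B" "subgraph ?C B"
    using ex_block_containing by blast
  have "u \<in> verts B" "w \<in> verts B"
    using B(2) p \<open>p \<noteq> []\<close> by (auto simp: subgraph_def)
  then have "u \<rightarrow>\<^bsub>B\<^esub> w"
    using blocks[OF B(1)] uw(3) by (auto simp: complete_graph_def complete_digraph_def)
  then have "u \<rightarrow>\<^bsub>G\<^esub> w"
    using B(1) adj_mono by (auto simp: block_def max_subgraph_def)
  then show False
    using uw(4) by contradiction
qed

text \<open>
  A walk avoiding \<open>c\<close> between two neighbours of \<open>c\<close> would make them equal or adjacent, but nonzero
  stress provides two neighbours that are neither.
\<close>

lemma cut_vertex_if_only_stressed_vertex: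
  assumes "stress G c \<noteq> 0"
    and stress: "\<And>v. v \<in> verts G \<Longrightarrow> v \<noteq> c \<Longrightarrow> stress G v = 0"
    and "connected G"
  shows "cut_vertex G c"
proof -
  let ?D = "G \<restriction> (verts G - {c})"
  obtain u w where uw: "u \<rightarrow>\<^bsub>G\<^esub> c" "c \<rightarrow>\<^bsub>G\<^esub> w" "u \<noteq> w" "\<not> u \<rightarrow>\<^bsub>G\<^esub> w"
    using assms(1) stress_nonzero_iff by auto
  have "subgraph ?D G"
    by (rule subgraph_induce_subgraphI) auto
  then have "\<not> u \<rightarrow>\<^sup>*\<^bsub>?D\<^esub> w"
    using adjacent_if_reachable_avoiding[of ?D c u w] stress uw by auto
  moreover have "u \<in> verts G - {c}" "w \<in> verts G - {c}" "c \<in> verts G"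
    using uw adj_in_verts adj_not_same by blast+
  ultimately show ?thesis
    by (auto simp: cut_vertex_iff[OF assms(3)])
qed

end

theorem theorem4p1:
  fixes G :: "('a, 'b) pre_digraph"
  assumes "graph G" and "connected G" and "card (verts G) \<ge> 3"
  shows "(\<exists>!v. v \<in> verts G \<and> stress G v \<noteq> 0) \<longleftrightarrow>
    (\<exists>!c. cut_vertex G c) \<and> (\<forall>B. block G B \<longrightarrow> complete_graph B)"
proof
  interpret graph G by (rule assms(1))
  have cut: "v \<in> verts G \<and> stress G v \<noteq> 0" if "cut_vertex G v" for v
    using that cut_vertex_imp_stress[OF assms(2)] by (auto simp: cut_vertex_def)
  {
    assume "\<exists>!v. v \<in> verts G \<and> stress G v \<noteq> 0"
    then obtain c where c: "stress G c \<noteq> 0"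
      and others: "\<And>v. v \<in> verts G \<Longrightarrow> v \<noteq> c \<Longrightarrow> stress G v = 0"
      by metis
    have "cut_vertex G c"
      using c others assms(2) by (rule cut_vertex_if_only_stressed_vertex)
    moreover have "v = c" if "cut_vertex G v" for v
      using cut[OF that] others by metis
    moreover have "complete_graph B" if "block G B" for B
      using others that by (rule block_complete_if_stress_zero)
    ultimately show "(\<exists>!c. cut_vertex G c) \<and> (\<forall>B. block G B \<longrightarrow> complete_graph B)"
      by blast
  next
    assume R: "(\<exists>!c. cut_vertex G c) \<and> (\<forall>B. block G B \<longrightarrow> complete_graph B)"
    then have "cut_vertex G v" if "stress G v \<noteq> 0" for v
      using cut_vertex_if_stress[OF assms(2) _ that] by blast
    then show "\<exists>!v. v \<in> verts G \<and> stress G v \<noteq> 0"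
      using R cut by blast
  }
qed

end
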